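(* Let $\mu,\nu\in\mathcal P_1^d$ with $\mu\preccurlyeq\nu$, and assume that $\delta F:=F_\nu-F_\mu$ has a single local maximizer on $(0,\infty)$. Then the lower bound price of the at-the-money forward start straddle of type I is attained by the Hobson–Klimmek coupling $\mathbb Q_{HK}(\mu,\nu)$, i.e. $$\inf_{Q\in\mathcal M(\mu,\nu)}\mathbb E^Q\left[\left|\frac{Y}{X}-1\right|\right]=\mathbb E^{\mathbb Q_{HK}(\mu,\nu)}\left[\left|\frac{Y}{X}-1\right|\right].$$
   Context: Notation: $\mathbb R_+^*=(0,\infty)$. $\mathcal P_1$ is the set of Borel probability measures $\mu$ on $\mathbb R_+^*$ with $\int x\,\mu(dx)=1$; $\mathcal P_1^d\subset\mathcal P_1$ is the subset of those having a positive density $p_\mu$ with respect to Lebesgue measure. $\mu\preccurlyeq\nu$ (convex order) means $\int f\,d\mu\le\int f\,d\nu$ for all convex $f:\mathbb R_+^*\to\mathbb R$. $F_\mu$ is the cumulative distribution function of $\mu$, $G_\mu(x)=\int_0^x y\,\mu(dy)$, $\delta F=F_\nu-F_\mu$, $\delta G=G_\nu-G_\mu$. On $(\mathbb R_+^* )^2$ let $X,Y$ be the coordinate maps $X(\omega_1,\omega_2)=\omega_1$, $Y(\omega_1,\omega_2)=\omega_2$. $\mathcal M(\mu,\nu)$ is the set of probability measures $Q$ on $(\mathbb R_+^* )^2$ such that under $Q$: $X\sim\mu$, $Y\sim\nu$, and $\mathbb E^Q[Y\mid X]=X$. Definition of $\mathbb Q_{HK}(\mu,\nu)$ (known theorem of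 Hobson and Klimmek): if $\mu,\nu\in\mathcal P_1^d$ satisfy $\mu\preccurlyeq\nu$ and $\delta F=F_\nu-F_\mu$ has a single local maximizer on $(0,\infty)$ (in which case $\delta F$ also has a unique global minimizer), then there is a unique coupling $\mathbb Q_{HK}(\mu,\nu)\in\mathcal M(\mu,\nu)$ attaining $\inf_{Q\in\mathcal M(\mu,\nu)}\mathbb E^Q[|Y-X|]$. It has the form $\mathbb Q_{HK}(\mu,\nu)(dx,dy)=\mu(dx)\mathcal L_{HK}(x,dy)$ with $$\mathcal L_{HK}(x,\cdot)=\delta_x\mathbf 1_{x\le a}+\big(l(x)\delta_{p(x)}+u(x)\delta_{q(x)}+(1-l(x)-u(x))\delta_x\big)\mathbf 1_{a<x<b}+\delta_x\mathbf 1_{x\ge b},$$ where $a$ (resp. $b$) is the global maximizer (resp. minimizer) of $\delta F$; $p:(a,b)\to[0,a]$ and $q:(a,b)\to[b,\infty]$ are continuous decreasing functions solving, for $x\in(a,b)$, $$\delta F(q(x))+\delta F(p(x))=\delta F(x),\qquad \delta G(q(x))+\delta G(p(x))=\delta G(x);$$ and $$u(x)=\frac{x-p(x)}{q(x)-p(x)}\,\frac{p_\mu(x)-p_\nu(x)}{p_\mu(x)},\qquad l(x)=\frac{q(x)-x}{q(x)-p(x)}\,\frac{p_\mu(x)-p_\nu(x)}{p_\mu(x)}.$$ *)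

theory Defs
  imports "HOL-Probability.Probability"
begin

text \<open>
  Measures on the open half line are represented as Borel measures on the reals that are
  concentrated on \<open>{0<..}\<close>.
\<close>

definition P1 :: "real measure set" where
  "P1 = {\<mu>. prob_space \<mu> \<and> sets \<mu> = sets borel \<and> (AE x in \<mu>. 0 < x) \<and>
             integrable \<mu> (\<lambda>x. x) \<and> (\<integral>x. x \<partial>\<mu>) = 1}"

definition has_positive_density :: "real measure \<Rightarrow> (real \<Rightarrow> real) \<Rightarrow> bool" where
  "has_positive_density \<mu> f \<longleftrightarrow>
     f \<in> borel_measurable borel \<and> (\<forall>x>0. 0 < f x) \<and>
     \<mu> = density lborel (\<lambda>x. indicator {0<..} x * ennreal (f x))"

definition P1d :: "real measure set" where
  "P1d = {\<mu> \<in> P1. \<exists>f. has_positive_density \<mu> f}"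

text \<open>
  A convex function lies above an affine one, so for measures in \<^const>\<open>P1\<close> its integral always
  exists in \<open>(-\<infinity>, \<infinity>]\<close>.  The inequality between these extended integrals is void if the right-hand
  side is infinite, and forces integrability on the left if the right-hand side is finite.
  Set integrals are used because \<open>f\<close> is arbitrary outside \<open>{0<..}\<close>.
\<close>

definition convex_order :: "real measure \<Rightarrow> real measure \<Rightarrow> bool" where
  "convex_order \<mu> \<nu> \<longleftrightarrow>
     (\<forall>f :: real \<Rightarrow> real. convex_on {0<..} f \<longrightarrow> set_integrable \<nu> {0<..} f \<longrightarrow>
        set_integrable \<mu> {0<..} f \<and> (LINT x:{0<..}|\<mu>. f x) \<le> (LINT x:{0<..}|\<nu>. f x))"

definition partial_mean :: "real measure \<Rightarrow> real \<Rightarrow> real" where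
  "partial_mean \<mu> x = (LINT y:{0<..x}|\<mu>. y)"

definition dF :: "real measure \<Rightarrow> real measure \<Rightarrow> real \<Rightarrow> real" where
  "dF \<mu> \<nu> x = cdf \<nu> x - cdf \<mu> x"

definition dG :: "real measure \<Rightarrow> real measure \<Rightarrow> real \<Rightarrow> real" where
  "dG \<mu> \<nu> x = partial_mean \<nu> x - partial_mean \<mu> x"

definition local_maximizer_on :: "real set \<Rightarrow> (real \<Rightarrow> real) \<Rightarrow> real \<Rightarrow> bool" where
  "local_maximizer_on S f x \<longleftrightarrow> x \<in> S \<and> (\<forall>\<^sub>F y in at x within S. f y \<le> f x)"

text \<open>
  Martingale couplings; \<open>X\<close> and \<open>Y\<close> are \<^const>\<open>fst\<close> and \<^const>\<open>snd\<close>.  Concentration on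
  \<open>{0<..} \<times> {0<..}\<close> follows from the marginals.
\<close>

definition martingale_couplings :: "real measure \<Rightarrow> real measure \<Rightarrow> (real \<times> real) measure set" where
  "martingale_couplings \<mu> \<nu> =
     {Q. prob_space Q \<and> sets Q = sets (borel \<Otimes>\<^sub>M borel) \<and>
         distr Q borel fst = \<mu> \<and> distr Q borel snd = \<nu> \<and>
         (AE \<omega> in Q. real_cond_exp Q (vimage_algebra (space Q) fst borel) snd \<omega> = fst \<omega>)}"

text \<open>
  The value at a Borel set \<open>B\<close> of the kernel \<open>\<L>\<^sub>H\<^sub>K(x, \<cdot>)\<close>; the Dirac mass \<open>\<delta>\<^sub>z(B)\<close> is
  \<open>indicator B z\<close>.
\<close>

definition HK_kernel ::
  "real \<Rightarrow> real \<Rightarrow> (real \<Rightarrow> real) \<Rightarrow> (real \<Rightarrow> real) \<Rightarrow> (real \<Rightarrow> real) \<Rightarrow> (real \<Rightarrow> real)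
    \<Rightarrow> real \<Rightarrow> real set \<Rightarrow> ennreal" where
  "HK_kernel a b p q l u x B =
     (if a < x \<and> x < b
      then ennreal (l x) * indicator B (p x) + ennreal (u x) * indicator B (q x)
           + ennreal (1 - l x - u x) * indicator B x
      else indicator B x)"

text \<open>
  The densities enter only up to null sets, so their choice does not matter.  For \<open>x\<close> strictly
  between \<open>a\<close> and \<open>b\<close> the two equations exclude the limiting values \<open>p x = 0\<close> and \<open>q x = \<infinity>\<close>, so
  that \<open>q\<close> can be taken real valued.
\<close>

definition HK_form :: "real measure \<Rightarrow> real measure \<Rightarrow> (real \<times> real) measure \<Rightarrow> bool" where
  "HK_form \<mu> \<nu> Q \<longleftrightarrow>
     (\<exists>f\<^sub>\<mu> f\<^sub>\<nu> a b p q l u.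
        has_positive_density \<mu> f\<^sub>\<mu> \<and> has_positive_density \<nu> f\<^sub>\<nu> \<and>
        0 < a \<and> (\<forall>x>0. dF \<mu> \<nu> x \<le> dF \<mu> \<nu> a) \<and>
        0 < b \<and> (\<forall>x>0. dF \<mu> \<nu> b \<le> dF \<mu> \<nu> x) \<and>
        p \<in> {a<..<b} \<rightarrow> {0..a} \<and> continuous_on {a<..<b} p \<and> antimono_on {a<..<b} p \<and>
        q \<in> {a<..<b} \<rightarrow> {b..} \<and> continuous_on {a<..<b} q \<and> antimono_on {a<..<b} q \<and>
        (\<forall>x\<in>{a<..<b}. dF \<mu> \<nu> (q x) + dF \<mu> \<nu> (p x) = dF \<mu> \<nu> x) \<and>
        (\<forall>x\<in>{a<..<b}. dG \<mu> \<nu> (q x) + dG \<mu> \<nu> (p x) = dG \<mu> \<nu> x) \<and>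
        (\<forall>x\<in>{a<..<b}. u x = (x - p x) / (q x - p x) * ((f\<^sub>\<mu> x - f\<^sub>\<nu> x) / f\<^sub>\<mu> x)) \<and>
        (\<forall>x\<in>{a<..<b}. l x = (q x - x) / (q x - p x) * ((f\<^sub>\<mu> x - f\<^sub>\<nu> x) / f\<^sub>\<mu> x)) \<and>
        (\<forall>A\<in>sets borel. \<forall>B\<in>sets borel.
           emeasure Q (A \<times> B) = (\<integral>\<^sup>+x\<in>A. HK_kernel a b p q l u x B \<partial>\<mu>)))"

text \<open>
  The Hobson--Klimmek coupling: the unique minimizer of the expected distance among all martingale
  couplings, together with its explicit form.  If \<open>\<mu>\<close> and \<open>\<nu>\<close> lie in \<^const>\<open>P1d\<close>, are in convex
  order and \<^term>\<open>dF \<mu> \<nu>\<close> has a single local maximizer, there is exactly one such coupling by the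
  theorem of Hobson and Klimmek.
\<close>

definition is_HK_coupling :: "real measure \<Rightarrow> real measure \<Rightarrow> (real \<times> real) measure \<Rightarrow> bool" where
  "is_HK_coupling \<mu> \<nu> Q \<longleftrightarrow>
     Q \<in> martingale_couplings \<mu> \<nu> \<and>
     (\<forall>Q'\<in>martingale_couplings \<mu> \<nu>.
        (\<integral>\<omega>. \<bar>snd \<omega> - fst \<omega>\<bar> \<partial>Q') =
          (INF R\<in>martingale_couplings \<mu> \<nu>. \<integral>\<omega>. \<bar>snd \<omega> - fst \<omega>\<bar> \<partial>R) \<longleftrightarrow> Q' = Q) \<and>
     HK_form \<mu> \<nu> Q"

end

(* Under a martingale coupling E[(Y - X)/X] = 0, so the cost |Y/X - 1| may be
   replaced by 2 max(Y - X, 0)/X.  It suffices to find a potential psi and a slope L with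
     psi(y) <= psi(x) + L(x)(y - x) + 2 max(y - x, 0)/x,
   with equality on the support of the Hobson-Klimmek coupling, i.e. for y = x and, if a < x < b,
   for y = p(x) and y = q(x): integrating gives E|Y/X - 1| >= int psi dnu - int psi dmu for every
   coupling, with equality for the Hobson-Klimmek one.

   The potential is a mixture over t in (a,b) of functions which are piecewise affine outside
   (a,b), with kinks at p(t) and q(t) of weights
     beta(t) = 2 q / (t^2 (q - p)),   alpha(t) = 2 p / (t^2 (q - p)).
   Only alpha, beta and gamma = alpha q = beta p enter the integrals.  The nonnegativity of alpha
   and beta, which is what makes the argument work for the cost |y - x|/x, and the monotonicity of
   p and q give the inequality and its equality cases. *)
theory Submission
  imports Defs
begin

section \<open>Integration under a martingale coupling\<close>

locale martingale_coupling = prob_space Q for Q :: "(real \<times> real) measure" +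
  fixes \<mu> \<nu> :: "real measure"
  assumes coupling: "Q \<in> martingale_couplings \<mu> \<nu>" and mu: "\<mu> \<in> P1" and nu: "\<nu> \<in> P1"
begin

lemma sets_Q [measurable_cong]: "sets Q = sets (borel \<Otimes>\<^sub>M borel)"
  using coupling by (simp add: martingale_couplings_def)

lemma marginals: "distr Q borel fst = \<mu>" "distr Q borel snd = \<nu>"
  using coupling by (simp_all add: martingale_couplings_def)

lemma AE_fst: "AE x in \<mu>. R x \<Longrightarrow> AE \<omega> in Q. R (fst \<omega>)"
  using AE_distrD[of fst Q borel R] unfolding marginals(1) by simp

lemma AE_snd: "AE y in \<nu>. R y \<Longrightarrow> AE \<omega> in Q. R (snd \<omega>)"
  using AE_distrD[of snd Q borel R] unfolding marginals(2) by simp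

lemma integral_fst: "integrable \<mu> f \<Longrightarrow> (\<integral>\<omega>. f (fst \<omega>) \<partial>Q) = (\<integral>x. f x \<partial>\<mu>)"
  for f :: "real \<Rightarrow> real"
  using marginals(1) by (intro integral_distr[of fst Q borel f, symmetric, THEN trans]) auto

lemma integrable_fst: "integrable \<mu> f \<Longrightarrow> integrable Q (\<lambda>\<omega>. f (fst \<omega>))"
  for f :: "real \<Rightarrow> real"
  using integrable_distr[of fst Q borel f] marginals(1) by simp

lemma integrable_snd: "integrable \<nu> f \<Longrightarrow> integrable Q (\<lambda>\<omega>. f (snd \<omega>))"
  for f :: "real \<Rightarrow> real"
  using integrable_distr[of snd Q borel f] marginals(2) by simp

lemma integral_snd: "integrable \<nu> f \<Longrightarrow> (\<integral>\<omega>. f (snd \<omega>) \<partial>Q) = (\<integral>y. f y \<partial>\<nu>)"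
  for f :: "real \<Rightarrow> real"
  using marginals(2) by (intro integral_distr[of snd Q borel f, symmetric, THEN trans]) auto

lemma AE_pos: "AE \<omega> in Q. 0 < fst \<omega> \<and> 0 < snd \<omega>"
  using AE_fst[of "\<lambda>x. 0 < x"] AE_snd[of "\<lambda>x. 0 < x"] mu nu by (auto simp: P1_def)

lemma integrable_coordinates: "integrable Q fst" "integrable Q snd"
  using integrable_fst[of "\<lambda>x. x"] integrable_snd[of "\<lambda>x. x"] mu nu by (auto simp: P1_def)

text \<open>A bounded function of the first coordinate can be pulled out of the conditional
  expectation, which equals \<open>fst\<close> almost everywhere. The bound on \<open>g\<close> is
  asked for positive arguments only, because the first coordinate is almost surely positive.\<close>

lemma integral_bounded_mult:
  assumes [measurable]: "g \<in> borel_measurable borel" and g: "\<And>x. 0 < x \<Longrightarrow> \<bar>g x\<bar> \<le> K"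
  shows "integrable Q (\<lambda>\<omega>. g (fst \<omega>) * fst \<omega>)" "integrable Q (\<lambda>\<omega>. g (fst \<omega>) * snd \<omega>)"
    "(\<integral>\<omega>. g (fst \<omega>) * snd \<omega> \<partial>Q) = (\<integral>\<omega>. g (fst \<omega>) * fst \<omega> \<partial>Q)"
proof -
  let ?F = "vimage_algebra (space Q) fst borel"
  have sub: "subalgebra Q ?F"
    unfolding subalgebra_def by (auto simp: sets_vimage_algebra2 intro!: measurable_sets)
  interpret sigma_finite_subalgebra Q ?F
    by (rule finite_measure_subalgebra_is_sigma_finite)
      (simp add: finite_measure_subalgebra_def finite_measure_subalgebra_axioms_def sub
        finite_measure_axioms)
  have bound: "integrable Q (\<lambda>\<omega>. g (fst \<omega>) * h \<omega>)" if h: "integrable Q h" for h :: "_ \<Rightarrow> real"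
  proof (rule Bochner_Integration.integrable_bound)
    show "integrable Q (\<lambda>\<omega>. K * \<bar>h \<omega>\<bar>)" using h by auto
    show "(\<lambda>\<omega>. g (fst \<omega>) * h \<omega>) \<in> borel_measurable Q"
      using borel_measurable_integrable[OF h] by measurable
    show "AE \<omega> in Q. norm (g (fst \<omega>) * h \<omega>) \<le> norm (K * \<bar>h \<omega>\<bar>)"
      using AE_pos
    proof eventually_elim
      case (elim \<omega>)
      then have "\<bar>g (fst \<omega>)\<bar> \<le> K" using g by simp
      then show ?case by (auto simp: abs_mult intro!: mult_right_mono)
    qed
  qed
  show "integrable Q (\<lambda>\<omega>. g (fst \<omega>) * fst \<omega>)"
    by (rule bound[OF integrable_coordinates(1)])
  show int: "integrable Q (\<lambda>\<omega>. g (fst \<omega>) * snd \<omega>)"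
    by (rule bound[OF integrable_coordinates(2)])
  have "fst \<in> ?F \<rightarrow>\<^sub>M borel" by (rule measurable_vimage_algebra1) auto
  then have "(\<lambda>\<omega>. g (fst \<omega>)) \<in> borel_measurable ?F" by measurable
  then have "(\<integral>\<omega>. g (fst \<omega>) * snd \<omega> \<partial>Q) = (\<integral>\<omega>. g (fst \<omega>) * real_cond_exp Q ?F snd \<omega> \<partial>Q)"
    using real_cond_exp_intg(2)[OF int] by simp
  also have "\<dots> = (\<integral>\<omega>. g (fst \<omega>) * fst \<omega> \<partial>Q)"
  proof (rule integral_cong_AE)
    show "AE \<omega> in Q. g (fst \<omega>) * real_cond_exp Q ?F snd \<omega> = g (fst \<omega>) * fst \<omega>"
      using coupling by (auto simp: martingale_couplings_def)
  qed measurable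
  finally show "(\<integral>\<omega>. g (fst \<omega>) * snd \<omega> \<partial>Q) = (\<integral>\<omega>. g (fst \<omega>) * fst \<omega> \<partial>Q)" .
qed

text \<open>Since 1/x is unbounded near 0, \<open>integral_bounded_mult\<close> is applied to
  truncations of 1/x, and the truncation is removed by monotone convergence. Integrability of the
  ratio also makes the cost integrable under every coupling, so its Bochner integral is a genuine
  expectation.\<close>

lemma ratio:
  shows integrable_ratio: "integrable Q (\<lambda>\<omega>. snd \<omega> / fst \<omega>)"
    and integral_ratio: "(\<integral>\<omega>. snd \<omega> / fst \<omega> \<partial>Q) = 1"
proof -
  define g :: "nat \<Rightarrow> real \<Rightarrow> real"
    where "g n x = (if 1 / real (Suc n) < x then 1 / x else 0)" for n x
  have g_meas [measurable]: "g n \<in> borel_measurable borel" for n unfolding g_def[abs_def] by measurable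
  have g_bd: "\<bar>g n x\<bar> \<le> real (Suc n)" if "0 < x" for n x
    using that by (auto simp: g_def divide_simps mult.commute)
  have ev: "eventually (\<lambda>n. g n x = 1 / x) sequentially" if x: "0 < x" for x
  proof -
    obtain N where N: "1 / real (Suc N) < x"
      using reals_Archimedean[OF x] unfolding inverse_eq_divide by blast
    have "g n x = 1 / x" if "N \<le> n" for n
    proof -
      have "1 / real (Suc n) \<le> 1 / real (Suc N)" using that by (intro divide_left_mono) auto
      then show ?thesis using N by (simp add: g_def)
    qed
    then show ?thesis unfolding eventually_sequentially by blast
  qed
  have mono_g: "mono (\<lambda>n. g n x)" if "0 < x" for x
  proof (rule monoI)
    fix m n :: nat assume "m \<le> n"
    then have "1 / real (Suc n) \<le> 1 / real (Suc m)" by (intro divide_left_mono) auto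
    then show "g m x \<le> g n x" using that by (auto simp: g_def)
  qed
  have int: "integrable Q (\<lambda>\<omega>. g n (fst \<omega>) * snd \<omega>)" for n
    by (rule integral_bounded_mult(2)[OF _ g_bd]) auto
  have mono: "AE \<omega> in Q. mono (\<lambda>n. g n (fst \<omega>) * snd \<omega>)"
    using AE_pos
    by eventually_elim (auto simp: mono_def intro!: mult_right_mono dest: monoD[OF mono_g])
  have lim: "AE \<omega> in Q. (\<lambda>n. g n (fst \<omega>) * snd \<omega>) \<longlonglongrightarrow> snd \<omega> / fst \<omega>"
    using AE_pos
  proof eventually_elim
    case (elim \<omega>)
    with ev[of "fst \<omega>"] have "eventually (\<lambda>n. g n (fst \<omega>) * snd \<omega> = snd \<omega> / fst \<omega>) sequentially"
      by (auto elim: eventually_mono)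
    then show ?case by (rule tendsto_eventually)
  qed
  \<comment> \<open>With \<open>fst\<close> as second factor the products are bounded by 1 and
    dominated convergence applies; the martingale property then transfers the limit to the products
    with \<open>snd\<close>.\<close>
  have "(\<lambda>n. \<integral>\<omega>. g n (fst \<omega>) * fst \<omega> \<partial>Q) \<longlonglongrightarrow> (\<integral>\<omega>. 1 \<partial>Q)"
  proof (rule integral_dominated_convergence[where w = "\<lambda>_. 1"])
    show "AE \<omega> in Q. (\<lambda>n. g n (fst \<omega>) * fst \<omega>) \<longlonglongrightarrow> 1"
      using AE_pos
    proof eventually_elim
      case (elim \<omega>)
      with ev[of "fst \<omega>"] have "eventually (\<lambda>n. g n (fst \<omega>) * fst \<omega> = 1) sequentially"
        by (auto elim: eventually_mono)
      then show ?case by (rule tendsto_eventually)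
    qed
    show "AE \<omega> in Q. norm (g n (fst \<omega>) * fst \<omega>) \<le> 1" for n
      by (auto simp: g_def)
  qed auto
  then have lim_int: "(\<lambda>n. \<integral>\<omega>. g n (fst \<omega>) * snd \<omega> \<partial>Q) \<longlonglongrightarrow> 1"
    by (subst integral_bounded_mult(3)[OF _ g_bd]) (auto simp: prob_space)
  show "integrable Q (\<lambda>\<omega>. snd \<omega> / fst \<omega>)"
    by (rule integrable_monotone_convergence[OF int mono lim lim_int]) measurable
  show "(\<integral>\<omega>. snd \<omega> / fst \<omega> \<partial>Q) = 1"
    by (rule integral_monotone_convergence[OF int mono lim lim_int]) measurable
qed

text \<open>For x > 0 the term 2 max(y - x, 0)/x equals |y/x - 1| + (y/x - 1). The second summand
  and the \<open>L\<close> term have mean zero, so the integrated slack of the dual inequality is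
  the cost minus the dual value.\<close>

lemma duality_gap:
  assumes [measurable]: "L \<in> borel_measurable borel" and L: "\<And>x. 0 < x \<Longrightarrow> \<bar>L x\<bar> \<le> K"
    and \<psi>: "integrable \<mu> \<psi>" "integrable \<nu> \<psi>"
  shows "(\<integral>\<omega>. \<bar>snd \<omega> / fst \<omega> - 1\<bar> \<partial>Q) - ((\<integral>y. \<psi> y \<partial>\<nu>) - (\<integral>x. \<psi> x \<partial>\<mu>)) =
    (\<integral>\<omega>. \<psi> (fst \<omega>) + L (fst \<omega>) * (snd \<omega> - fst \<omega>) + 2 * max (snd \<omega> - fst \<omega>) 0 / fst \<omega>
         - \<psi> (snd \<omega>) \<partial>Q)"
proof -
  note g = integral_bounded_mult[OF assms(1) L]
  have abs_int: "integrable Q (\<lambda>\<omega>. \<bar>snd \<omega> / fst \<omega> - 1\<bar>)"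
    using integrable_ratio by auto
  have "(\<integral>\<omega>. \<psi> (fst \<omega>) + L (fst \<omega>) * (snd \<omega> - fst \<omega>) + 2 * max (snd \<omega> - fst \<omega>) 0 / fst \<omega>
         - \<psi> (snd \<omega>) \<partial>Q) =
     (\<integral>\<omega>. \<psi> (fst \<omega>) + (L (fst \<omega>) * snd \<omega> - L (fst \<omega>) * fst \<omega>)
        + (\<bar>snd \<omega> / fst \<omega> - 1\<bar> + (snd \<omega> / fst \<omega> - 1)) - \<psi> (snd \<omega>) \<partial>Q)"
  proof (rule integral_cong_AE)
    have [measurable]: "(\<lambda>\<omega>. \<psi> (fst \<omega>)) \<in> borel_measurable Q" "(\<lambda>\<omega>. \<psi> (snd \<omega>)) \<in> borel_measurable Q"
      using integrable_fst[OF \<psi>(1)] integrable_snd[OF \<psi>(2)] by auto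
    show "(\<lambda>\<omega>. \<psi> (fst \<omega>) + L (fst \<omega>) * (snd \<omega> - fst \<omega>) + 2 * max (snd \<omega> - fst \<omega>) 0 / fst \<omega>
         - \<psi> (snd \<omega>)) \<in> borel_measurable Q"
      by measurable
    show "(\<lambda>\<omega>. \<psi> (fst \<omega>) + (L (fst \<omega>) * snd \<omega> - L (fst \<omega>) * fst \<omega>)
        + (\<bar>snd \<omega> / fst \<omega> - 1\<bar> + (snd \<omega> / fst \<omega> - 1)) - \<psi> (snd \<omega>)) \<in> borel_measurable Q"
      by measurable
    show "AE \<omega> in Q. \<psi> (fst \<omega>) + L (fst \<omega>) * (snd \<omega> - fst \<omega>)
         + 2 * max (snd \<omega> - fst \<omega>) 0 / fst \<omega> - \<psi> (snd \<omega>) =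
       \<psi> (fst \<omega>) + (L (fst \<omega>) * snd \<omega> - L (fst \<omega>) * fst \<omega>)
        + (\<bar>snd \<omega> / fst \<omega> - 1\<bar> + (snd \<omega> / fst \<omega> - 1)) - \<psi> (snd \<omega>)"
      using AE_pos
    proof eventually_elim
      case (elim \<omega>)
      then have "2 * max (snd \<omega> - fst \<omega>) 0 / fst \<omega> =
          \<bar>snd \<omega> / fst \<omega> - 1\<bar> + (snd \<omega> / fst \<omega> - 1)"
        by (auto simp: max_def abs_if field_simps)
      then show ?case by (simp add: algebra_simps)
    qed
  qed
  also have "\<dots> = (\<integral>x. \<psi> x \<partial>\<mu>) + (\<integral>\<omega>. \<bar>snd \<omega> / fst \<omega> - 1\<bar> \<partial>Q) - (\<integral>y. \<psi> y \<partial>\<nu>)"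
    using abs_int integrable_ratio g integrable_fst[OF \<psi>(1)] integrable_snd[OF \<psi>(2)]
    by (simp add: integral_ratio integral_fst[OF \<psi>(1)] integral_snd[OF \<psi>(2)] prob_space)
  finally show ?thesis by simp
qed

end

section \<open>The dual potential for abstract weights\<close>

text \<open>The kinks are implicit as p = \<gamma>/\<beta> and q = \<gamma>/\<alpha>:
  \<open>gamma_le\<close> expresses p \<le> a and \<open>gamma_ge\<close> expresses b \<le> q.
  Multiplying out avoids the quotient \<gamma>/\<alpha>, which is meaningless where p = 0.\<close>

locale dual_weights =
  fixes a b :: real and \<alpha> \<beta> \<gamma> :: "real \<Rightarrow> real"
  assumes a_pos: "0 < a" and a_less_b: "a < b"
    and alpha_int [intro]: "integrable lborel \<alpha>"
    and beta_int [intro]: "integrable lborel \<beta>"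
    and gamma_int [intro]: "integrable lborel \<gamma>"
    and alpha_nonneg: "0 \<le> \<alpha> t" and beta_nonneg: "0 \<le> \<beta> t" and gamma_nonneg: "0 \<le> \<gamma> t"
    and beta_minus_alpha: "\<beta> t - \<alpha> t = indicator {a<..<b} t * (2 / t\<^sup>2)"
    and gamma_le: "\<gamma> t \<le> \<beta> t * a" and gamma_ge: "\<alpha> t * b \<le> \<gamma> t"
    and beta_outside: "t \<notin> {a<..<b} \<Longrightarrow> \<beta> t = 0"
begin

lemma alpha_outside: "t \<notin> {a<..<b} \<Longrightarrow> \<alpha> t = 0"
  using beta_minus_alpha[of t] beta_outside[of t] by auto

lemma gamma_outside: "t \<notin> {a<..<b} \<Longrightarrow> \<gamma> t = 0"
  using gamma_le[of t] gamma_nonneg[of t] beta_outside[of t] by auto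

lemma weights_measurable [measurable]:
  "\<alpha> \<in> borel_measurable borel" "\<beta> \<in> borel_measurable borel" "\<gamma> \<in> borel_measurable borel"
  using alpha_int beta_int gamma_int by auto

definition cumulative :: "(real \<Rightarrow> real) \<Rightarrow> real \<Rightarrow> real" where
  "cumulative f x = (\<integral>t. (if t < x then f t else 0) \<partial>lborel)"

text \<open>The integrand is \<beta> times the positive part of p - y; in
  \<open>upper_excess\<close> it is \<alpha> times the positive part of y - q.\<close>

definition lower_excess :: "real \<Rightarrow> real" where
  "lower_excess y = (\<integral>t. max (\<gamma> t - \<beta> t * y) 0 \<partial>lborel)"

definition upper_excess :: "real \<Rightarrow> real" where
  "upper_excess y = (\<integral>t. max (\<alpha> t * y - \<gamma> t) 0 \<partial>lborel)"

text \<open>Minus the right derivative of \<open>lower_excess\<close>; \<open>upper_slope\<close> is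
  the right derivative of \<open>upper_excess\<close>.\<close>

definition lower_slope :: "real \<Rightarrow> real" where
  "lower_slope x = (\<integral>t. (if \<beta> t * x < \<gamma> t then \<beta> t else 0) \<partial>lborel)"

definition upper_slope :: "real \<Rightarrow> real" where
  "upper_slope x = (\<integral>t. (if \<gamma> t \<le> \<alpha> t * x then \<alpha> t else 0) \<partial>lborel)"

text \<open>The middle piece is the integral of \<beta>(t)(y - p(t)) over t < y. The pieces agree at
  a and at b, where the excesses vanish, and both outer pieces are concave.\<close>

definition potential :: "real \<Rightarrow> real" where
  "potential y =
     (if y \<le> a then - lower_excess y
      else if y < b then cumulative \<beta> y * y - cumulative \<gamma> y
      else cumulative \<beta> b * y - cumulative \<gamma> b + 2 * y / b - 2 - upper_excess y)"

text \<open>For a < x < b this turns the line through the potential at x into the integral of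
  \<beta>(t)(y - p(t)) over t < x. For x \<le> a it is the right derivative of the lower piece. For
  x \<ge> b it is the right derivative of the upper piece minus 2/x, which the kink at x adds back
  for y > x.\<close>

definition slope :: "real \<Rightarrow> real" where
  "slope x =
     (if x \<le> a then lower_slope x
      else if x < b then cumulative \<beta> x
      else cumulative \<beta> b + 2 / b - 2 / x - upper_slope x)"

lemma int_truncate [intro]:
  assumes "integrable lborel f"
  shows "integrable lborel (\<lambda>t. if t < (x::real) then f t else (0::real))"
proof -
  have "(\<lambda>t. if t < x then f t else 0) = (\<lambda>t. indicator {..<x} t *\<^sub>R f t)"
    by (auto simp: fun_eq_iff indicator_def)
  then show ?thesis using integrable_mult_indicator[OF _ assms, of "{..<x}"] by simp
qed

lemma int_excess:
  "integrable lborel (\<lambda>t. max (\<gamma> t - \<beta> t * y) 0)"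
  "integrable lborel (\<lambda>t. max (\<alpha> t * y - \<gamma> t) 0)"
  by (intro integrable_max Bochner_Integration.integrable_diff integrable_mult_left; auto)+

lemma int_slope:
  "integrable lborel (\<lambda>t. if \<beta> t * x < \<gamma> t then \<beta> t else 0)"
  "integrable lborel (\<lambda>t. if \<gamma> t \<le> \<alpha> t * x then \<alpha> t else 0)"
  by (rule Bochner_Integration.integrable_bound[OF beta_int]; auto)
     (rule Bochner_Integration.integrable_bound[OF alpha_int]; auto)

lemma cumulative_at_a:
  "cumulative \<alpha> a = 0" "cumulative \<beta> a = 0" "cumulative \<gamma> a = 0"
  unfolding cumulative_def
  using alpha_outside beta_outside gamma_outside
  by (auto intro!: integral_eq_zero_AE)

lemma cumulative_at_b:
  "cumulative \<alpha> b = integral\<^sup>L lborel \<alpha>" "cumulative \<beta> b = integral\<^sup>L lborel \<beta>"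
  "cumulative \<gamma> b = integral\<^sup>L lborel \<gamma>"
  unfolding cumulative_def
  using alpha_outside beta_outside gamma_outside
  by (auto intro!: Bochner_Integration.integral_cong)

lemma cumulative_mono:
  assumes "integrable lborel f" "\<And>t. 0 \<le> f t"
  shows "mono (cumulative f)"
  unfolding mono_def cumulative_def
proof (intro allI impI integral_mono)
  fix x y t :: real assume "x \<le> y"
  then show "(if t < x then f t else 0) \<le> (if t < y then f t else 0)"
    using assms(2)[of t] by (auto simp: indicator_def)
qed (use assms in auto)

lemma lower_excess_antimono: "mono (\<lambda>y. - lower_excess y)"
  unfolding mono_def lower_excess_def neg_le_iff_le
  by (intro allI impI integral_mono int_excess max.mono diff_mono mult_left_mono)
    (auto simp: beta_nonneg)

lemma upper_excess_mono: "mono upper_excess"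
  unfolding mono_def upper_excess_def
  by (intro allI impI integral_mono int_excess max.mono diff_mono mult_left_mono)
    (auto simp: alpha_nonneg)

lemma lower_slope_antimono: "mono (\<lambda>x. - lower_slope x)"
  unfolding mono_def lower_slope_def neg_le_iff_le
proof (intro allI impI integral_mono int_slope)
  fix x y t :: real assume "x \<le> y"
  then have "\<beta> t * x \<le> \<beta> t * y" using beta_nonneg by (intro mult_left_mono) auto
  then show "(if \<beta> t * y < \<gamma> t then \<beta> t else 0) \<le> (if \<beta> t * x < \<gamma> t then \<beta> t else 0)"
    using beta_nonneg[of t] by auto
qed

lemma upper_slope_mono: "mono upper_slope"
  unfolding mono_def upper_slope_def
proof (intro allI impI integral_mono int_slope)
  fix x y t :: real assume "x \<le> y"
  then have "\<alpha> t * x \<le> \<alpha> t * y" using alpha_nonneg by (intro mult_left_mono) auto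
  then show "(if \<gamma> t \<le> \<alpha> t * x then \<alpha> t else 0) \<le> (if \<gamma> t \<le> \<alpha> t * y then \<alpha> t else 0)"
    using alpha_nonneg[of t] by auto
qed

lemma pieces_measurable [measurable]:
  "cumulative \<beta> \<in> borel_measurable borel" "cumulative \<gamma> \<in> borel_measurable borel"
  "lower_excess \<in> borel_measurable borel" "upper_excess \<in> borel_measurable borel"
  "lower_slope \<in> borel_measurable borel" "upper_slope \<in> borel_measurable borel"
proof -
  show "cumulative \<beta> \<in> borel_measurable borel" "cumulative \<gamma> \<in> borel_measurable borel"
    "upper_excess \<in> borel_measurable borel" "upper_slope \<in> borel_measurable borel"
    using cumulative_mono[OF beta_int beta_nonneg] cumulative_mono[OF gamma_int gamma_nonneg]
      upper_excess_mono upper_slope_mono by (simp_all add: borel_measurable_mono)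
  show "lower_excess \<in> borel_measurable borel" "lower_slope \<in> borel_measurable borel"
    using borel_measurable_uminus[OF borel_measurable_mono[OF lower_excess_antimono]]
      borel_measurable_uminus[OF borel_measurable_mono[OF lower_slope_antimono]] by simp_all
qed

lemma potential_measurable [measurable]: "potential \<in> borel_measurable borel"
  unfolding potential_def[abs_def] by measurable

lemma slope_measurable [measurable]: "slope \<in> borel_measurable borel"
  unfolding slope_def[abs_def] by measurable

lemma lower_excess_nonneg: "0 \<le> lower_excess y"
  unfolding lower_excess_def by (rule Bochner_Integration.integral_nonneg) auto

lemma lower_slope_bounds: "0 \<le> lower_slope x" "lower_slope x \<le> cumulative \<beta> b"
  unfolding lower_slope_def cumulative_at_b
  by (auto intro!: Bochner_Integration.integral_nonneg integral_mono int_slope simp: beta_nonneg)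

lemma upper_slope_bounds: "0 \<le> upper_slope x" "upper_slope x \<le> cumulative \<alpha> b"
  unfolding upper_slope_def cumulative_at_b
  by (auto intro!: Bochner_Integration.integral_nonneg integral_mono int_slope simp: alpha_nonneg)

lemma lower_excess_at_a: "lower_excess a = 0"
proof -
  have "max (\<gamma> t - \<beta> t * a) 0 = 0" for t using gamma_le[of t] by simp
  then show ?thesis by (simp add: lower_excess_def)
qed

lemma upper_excess_eq_0: "y \<le> b \<Longrightarrow> upper_excess y = 0"
proof -
  assume "y \<le> b"
  then have "max (\<alpha> t * y - \<gamma> t) 0 = 0" for t
    using gamma_ge[of t] mult_left_mono[of y b "\<alpha> t"] alpha_nonneg[of t] by simp
  then show ?thesis by (simp add: upper_excess_def)
qed

text \<open>Keeping only t < x and dropping the positive part can only decrease the integral. For a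
  < x < b the resulting affine minorant is minus the line with slope \<open>slope x\<close> through
  the potential at x.\<close>

lemma lower_excess_ge: "cumulative \<gamma> x - cumulative \<beta> x * y \<le> lower_excess y"
proof -
  have "cumulative \<gamma> x - cumulative \<beta> x * y =
      (\<integral>t. (if t < x then \<gamma> t else 0) - (if t < x then \<beta> t else 0) * y \<partial>lborel)"
    unfolding cumulative_def
    by (subst Bochner_Integration.integral_diff) (auto intro!: integrable_mult_left)
  also have "\<dots> \<le> lower_excess y"
    unfolding lower_excess_def
    by (intro integral_mono int_excess Bochner_Integration.integrable_diff integrable_mult_left)
      (auto simp: indicator_def)
  finally show ?thesis .
qed

text \<open>The minorant is attained if the integrand changes sign at t = x, that is, if p(t) is
  above y before x and below y from x on.\<close>

lemma lower_excess_eq: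
  assumes "\<And>t. t < x \<Longrightarrow> \<beta> t * y \<le> \<gamma> t" "\<And>t. x \<le> t \<Longrightarrow> \<gamma> t \<le> \<beta> t * y"
  shows "lower_excess y = cumulative \<gamma> x - cumulative \<beta> x * y"
proof -
  have "cumulative \<gamma> x - cumulative \<beta> x * y =
      (\<integral>t. (if t < x then \<gamma> t else 0) - (if t < x then \<beta> t else 0) * y \<partial>lborel)"
    unfolding cumulative_def
    by (subst Bochner_Integration.integral_diff) (auto intro!: integrable_mult_left)
  also have "\<dots> = lower_excess y"
    unfolding lower_excess_def
    by (rule Bochner_Integration.integral_cong) (use assms in \<open>auto simp: indicator_def not_less\<close>)
  finally show ?thesis by simp
qed

lemma upper_excess_as_integral:
  "(cumulative \<alpha> b - cumulative \<alpha> x) * y - (cumulative \<gamma> b - cumulative \<gamma> x) =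
   (\<integral>t. (\<alpha> t - (if t < x then \<alpha> t else 0)) * y - (\<gamma> t - (if t < x then \<gamma> t else 0)) \<partial>lborel)"
proof -
  have "integrable lborel (\<lambda>t. \<alpha> t - (if t < x then \<alpha> t else 0))"
    "integrable lborel (\<lambda>t. \<gamma> t - (if t < x then \<gamma> t else 0))"
    by (intro Bochner_Integration.integrable_diff int_truncate alpha_int gamma_int)+
  then show ?thesis
    unfolding cumulative_at_b unfolding cumulative_def
    by (simp add: Bochner_Integration.integral_diff int_truncate alpha_int gamma_int)
qed

text \<open>Here the integrand is kept for t \<ge> x instead of t < x: for decreasing q this range
  gives q(t) \<le> q(x).\<close>

lemma upper_excess_ge:
  "(cumulative \<alpha> b - cumulative \<alpha> x) * y - (cumulative \<gamma> b - cumulative \<gamma> x) \<le> upper_excess y"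
  unfolding upper_excess_as_integral upper_excess_def
  by (intro integral_mono int_excess Bochner_Integration.integrable_diff integrable_mult_left)
    (auto simp: indicator_def)

lemma upper_excess_eq:
  assumes "\<And>t. t < x \<Longrightarrow> \<alpha> t * y \<le> \<gamma> t" "\<And>t. x \<le> t \<Longrightarrow> \<gamma> t \<le> \<alpha> t * y"
  shows "upper_excess y = (cumulative \<alpha> b - cumulative \<alpha> x) * y - (cumulative \<gamma> b - cumulative \<gamma> x)"
  unfolding upper_excess_as_integral upper_excess_def
  by (rule Bochner_Integration.integral_cong) (use assms in \<open>auto simp: indicator_def not_less\<close>)

text \<open>Subgradient inequality of the positive part, integrated over t.\<close>

lemma lower_excess_convex: "lower_excess x + lower_slope x * (x - y) \<le> lower_excess y"
proof -
  have "lower_excess x + lower_slope x * (x - y) =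
     (\<integral>t. max (\<gamma> t - \<beta> t * x) 0 + (if \<beta> t * x < \<gamma> t then \<beta> t else 0) * (x - y) \<partial>lborel)"
    unfolding lower_excess_def lower_slope_def
    by (subst Bochner_Integration.integral_add)
      (auto intro!: integrable_mult_left int_slope int_excess)
  also have "\<dots> \<le> lower_excess y"
    unfolding lower_excess_def
    by (intro integral_mono int_excess Bochner_Integration.integrable_add integrable_mult_left
        int_slope) (auto simp: max_def algebra_simps)
  finally show ?thesis .
qed

lemma upper_excess_convex: "upper_excess x + upper_slope x * (y - x) \<le> upper_excess y"
proof -
  have "upper_excess x + upper_slope x * (y - x) =
     (\<integral>t. max (\<alpha> t * x - \<gamma> t) 0 + (if \<gamma> t \<le> \<alpha> t * x then \<alpha> t else 0) * (y - x) \<partial>lborel)"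
    unfolding upper_excess_def upper_slope_def
    by (subst Bochner_Integration.integral_add)
      (auto intro!: integrable_mult_left int_slope int_excess)
  also have "\<dots> \<le> upper_excess y"
    unfolding upper_excess_def
    by (intro integral_mono int_excess Bochner_Integration.integrable_add integrable_mult_left
        int_slope) (auto simp: max_def algebra_simps)
  finally show ?thesis .
qed

text \<open>For t between x and y the kink q(t) is at least b, hence at least y, so \<alpha>(t)(y -
  q(t)) is nonpositive.\<close>

lemma cumulative_gamma_ge:
  assumes "x \<le> y" "y \<le> b"
  shows "(cumulative \<alpha> y - cumulative \<alpha> x) * y \<le> cumulative \<gamma> y - cumulative \<gamma> x"
proof -
  have "(cumulative \<alpha> y - cumulative \<alpha> x) * y =
     (\<integral>t. ((if t < y then \<alpha> t else 0) - (if t < x then \<alpha> t else 0)) * y \<partial>lborel)"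
    unfolding cumulative_def
    by (simp add: Bochner_Integration.integral_diff int_truncate alpha_int)
  also have "\<dots> \<le> (\<integral>t. (if t < y then \<gamma> t else 0) - (if t < x then \<gamma> t else 0) \<partial>lborel)"
  proof (intro integral_mono Bochner_Integration.integrable_diff integrable_mult_left)
    fix t
    have "\<alpha> t * y \<le> \<gamma> t"
      using gamma_ge[of t] mult_left_mono[OF assms(2) alpha_nonneg[of t]] by simp
    then show "((if t < y then \<alpha> t else 0) - (if t < x then \<alpha> t else 0)) * y
        \<le> (if t < y then \<gamma> t else 0) - (if t < x then \<gamma> t else 0)"
      using assms(1) by (auto simp: indicator_def)
  qed auto
  also have "\<dots> = cumulative \<gamma> y - cumulative \<gamma> x"
    unfolding cumulative_def
    by (simp add: Bochner_Integration.integral_diff int_truncate gamma_int)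
  finally show ?thesis .
qed

text \<open>Mirror image of the preceding bound, from p(t) \<le> a \<le> x.\<close>

lemma cumulative_gamma_le:
  assumes "a \<le> x" "x \<le> y"
  shows "cumulative \<gamma> y - cumulative \<gamma> x \<le> (cumulative \<beta> y - cumulative \<beta> x) * x"
proof -
  have "cumulative \<gamma> y - cumulative \<gamma> x =
      (\<integral>t. (if t < y then \<gamma> t else 0) - (if t < x then \<gamma> t else 0) \<partial>lborel)"
    unfolding cumulative_def
    by (simp add: Bochner_Integration.integral_diff int_truncate gamma_int)
  also have "\<dots> \<le> (\<integral>t. ((if t < y then \<beta> t else 0) - (if t < x then \<beta> t else 0)) * x \<partial>lborel)"
  proof (intro integral_mono Bochner_Integration.integrable_diff integrable_mult_left)
    fix t
    have "\<gamma> t \<le> \<beta> t * x"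
      using gamma_le[of t] mult_left_mono[OF assms(1) beta_nonneg[of t]] by simp
    then show "(if t < y then \<gamma> t else 0) - (if t < x then \<gamma> t else 0)
        \<le> ((if t < y then \<beta> t else 0) - (if t < x then \<beta> t else 0)) * x"
      using assms(2) by (auto simp: indicator_def)
  qed auto
  also have "\<dots> = (cumulative \<beta> y - cumulative \<beta> x) * x"
    unfolding cumulative_def
    by (simp add: Bochner_Integration.integral_diff int_truncate beta_int)
  finally show ?thesis .
qed

text \<open>On (a,b) the difference \<beta> - \<alpha> is the derivative of -2/t. This is where the
  weights match the cost: adding the kink slope 2/x to \<open>cumulative \<beta> x\<close> gives
  \<open>cumulative \<alpha> x + 2 / a\<close>, so that comparisons right of x run through \<alpha>
  and q.\<close>

lemma cumulative_alpha:
  assumes "a \<le> x" "x \<le> b"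
  shows "cumulative \<alpha> x + 2 / a = cumulative \<beta> x + 2 / x"
proof -
  have "((\<lambda>t. - 2 / t) has_real_derivative 2 / t\<^sup>2) (at t)" if "t \<in> {a..x}" for t
    using that a_pos by (auto intro!: derivative_eq_intros simp: power2_eq_square)
  moreover have "continuous_on {a..x} (\<lambda>t. 2 / t\<^sup>2)"
    using a_pos by (auto intro!: continuous_intros)
  ultimately have FTC: "(\<integral>t. indicator {a..x} t *\<^sub>R (2 / t\<^sup>2) \<partial>lborel) = - 2 / x - (- 2 / a)"
    using assms(1) by (intro integral_FTC_Icc)
      (auto simp: has_real_derivative_iff_has_vector_derivative[symmetric]
            intro: has_field_derivative_at_within)
  have "cumulative \<beta> x - cumulative \<alpha> x =
      (\<integral>t. (if t < x then \<beta> t else 0) - (if t < x then \<alpha> t else 0) \<partial>lborel)"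
    unfolding cumulative_def
    by (simp add: Bochner_Integration.integral_diff int_truncate beta_int alpha_int)
  also have "\<dots> = (\<integral>t. indicator {a..x} t *\<^sub>R (2 / t\<^sup>2) \<partial>lborel)"
  proof (rule integral_cong_AE)
    show "AE t in lborel. (if t < x then \<beta> t else 0) - (if t < x then \<alpha> t else 0) =
        indicator {a..x} t *\<^sub>R (2 / t\<^sup>2)"
      \<comment> \<open>The two sides may differ at the endpoints: the weights vanish at a, and the
        truncation t < x is strict.\<close>
      using AE_lborel_singleton[of a] AE_lborel_singleton[of x]
    proof eventually_elim
      case (elim t)
      have "(if t < x then \<beta> t else 0) - (if t < x then \<alpha> t else 0) = (if t < x then \<beta> t - \<alpha> t else 0)"
        by (simp add: algebra_simps)
      then show ?case
        unfolding beta_minus_alpha using elim assms by (auto simp: indicator_def)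
    qed
  qed measurable
  finally show ?thesis using FTC by simp
qed

text \<open>The cases are the positions of x and y relative to a and b. For a < x < b, points y
  \<le> x are compared through \<beta> and p, points y > x through \<alpha> and q after
  \<open>cumulative_alpha\<close>. For x outside (a,b), concavity of the outer piece of the
  potential is used as well.\<close>

lemma potential_le:
  assumes x: "0 < x" and y: "0 \<le> y"
  shows "potential y \<le> potential x + slope x * (y - x) + 2 * max (y - x) 0 / x"
proof -
  define e where "e = 2 * max (y - x) 0 / x"
  \<comment> \<open>The kink term is the larger of 0 and 2y/x - 2; each case below uses one of these
    two bounds.\<close>
  have e0: "0 \<le> e" using x by (simp add: e_def)
  have e1: "2 * y / x - 2 \<le> e" using x by (auto simp: e_def field_simps max_def)
  have ab: "a < b" "0 < a" "0 < b" using a_pos a_less_b by auto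
  have Ab: "(cumulative \<alpha> b + 2 / a) * y = (cumulative \<beta> b + 2 / b) * y"
    using cumulative_alpha[of b] ab by simp
  note conv = algebra_simps
  consider "x \<le> a" | "a < x" "x < b" | "b \<le> x" by linarith
  then show ?thesis
  proof cases
    case 1
    have t: "2 * y / a \<le> 2 * y / x" using 1 x y by (intro divide_left_mono) auto
    have px: "potential x = - lower_excess x" "slope x = lower_slope x"
      using 1 by (auto simp: potential_def slope_def)
    \<comment> \<open>The tangent to the concave lower piece is at least 0 at a and has nonnegative
      slope, so it stays nonnegative beyond a. For y > a it then suffices that the potential is at
      most 2y/a - 2, which the kink dominates because x \<le> a.\<close>
    have nn: "0 \<le> - lower_excess x + lower_slope x * (y - x)" if "a \<le> y"
    proof -
      have "lower_excess x + lower_slope x * (x - a) \<le> 0"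
        using lower_excess_convex[of x a] lower_excess_at_a by simp
      moreover have "lower_slope x * (x - y) \<le> lower_slope x * (x - a)"
        using that lower_slope_bounds by (intro mult_left_mono) auto
      ultimately show ?thesis by (simp add: conv)
    qed
    consider "y \<le> a" | "a < y" "y < b" | "b \<le> y" by linarith
    then have "potential y \<le> potential x + slope x * (y - x) + e"
    proof cases
      case 1
      then show ?thesis
        using lower_excess_convex[of x y] e0 px by (simp add: potential_def conv)
    next
      case 2
      have "(cumulative \<alpha> y + 2 / a) * y = (cumulative \<beta> y + 2 / y) * y"
        using cumulative_alpha[of y] 2 by simp
      moreover have "2 / y * y = 2" using 2 ab by simp
      ultimately show ?thesis
        using cumulative_gamma_ge[of a y] 2 nn t e1 px
        by (simp add: potential_def conv cumulative_at_a)
    next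
      case 3
      then show ?thesis
        using upper_excess_ge[of a y] nn t e1 px ab Ab
        by (simp add: potential_def conv cumulative_at_a)
    qed
    then show ?thesis by (simp add: e_def)
  next
    case 2
    have px: "potential x + slope x * (y - x) = cumulative \<beta> x * y - cumulative \<gamma> x"
      using 2 by (simp add: potential_def slope_def conv)
    have Ax: "(cumulative \<alpha> x + 2 / a) * y = (cumulative \<beta> x + 2 / x) * y"
      using cumulative_alpha[of x] 2 by simp
    consider "y \<le> a" | "a < y" "y < b" "y \<le> x" | "a < y" "y < b" "x < y" | "b \<le> y" by linarith
    then have "potential y \<le> potential x + slope x * (y - x) + e"
    proof cases
      case 1
      then show ?thesis unfolding px
        using lower_excess_ge[of x y] e0 by (simp add: potential_def conv)
    next
      case 2
      then show ?thesis unfolding px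
        using cumulative_gamma_le[of y x] e0 by (simp add: potential_def conv)
    next
      case 3
      have "(cumulative \<alpha> y + 2 / a) * y = (cumulative \<beta> y + 2 / y) * y"
        using cumulative_alpha[of y] 3 by simp
      moreover have "2 / y * y = 2" using 3 ab by simp
      ultimately show ?thesis unfolding px
        using cumulative_gamma_ge[of x y] 3 e1 Ax by (simp add: potential_def conv)
    next
      case 4
      then show ?thesis unfolding px
        using upper_excess_ge[of x y] e1 Ax Ab ab by (simp add: potential_def conv)
    qed
    then show ?thesis by (simp add: e_def)
  next
    case 3
    have "2 / x * x = 2" using x by simp
    then have px: "potential x + slope x * (y - x) =
        cumulative \<beta> b * y - cumulative \<gamma> b + 2 * y / b - 2 * y / x
        - (upper_excess x + upper_slope x * (y - x))"
      using 3 ab by (simp add: potential_def slope_def conv diff_divide_distrib)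
    \<comment> \<open>As x \<ge> b, the extra slope 2/b - 2/x is nonnegative, so for y \<le> b the
      right-hand side stays above the line
      \<open>cumulative \<beta> b * y - cumulative \<gamma> b\<close>.\<close>
    have t: "2 * y / x \<le> 2 * y / b" using 3 ab y by (intro divide_left_mono) auto
    have R: "upper_excess x + upper_slope x * (y - x) \<le> upper_excess y"
      by (rule upper_excess_convex)
    consider "y \<le> a" | "a < y" "y < b" | "b \<le> y" by linarith
    then have "potential y \<le> potential x + slope x * (y - x) + e"
    proof cases
      case 1
      then show ?thesis unfolding px
        using lower_excess_ge[of b y] e0 t R upper_excess_eq_0[of y] ab
        by (simp add: potential_def conv)
    next
      case 2
      then show ?thesis unfolding px
        using cumulative_gamma_le[of y b] e0 t R upper_excess_eq_0[of y] ab
        by (simp add: potential_def conv)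
    next
      case 3
      then show ?thesis unfolding px
        using e1 R ab by (simp add: potential_def conv)
    qed
    then show ?thesis by (simp add: e_def)
  qed
qed

text \<open>The conditions on t say that the kinks p(t) pass y from above at t = x, so
  \<open>lower_excess_eq\<close> applies; the max term vanishes since y < x.\<close>

lemma potential_eq_lower:
  assumes x: "a < x" "x < b" and y: "y \<le> a"
    and "\<And>t. t < x \<Longrightarrow> \<beta> t * y \<le> \<gamma> t" "\<And>t. x \<le> t \<Longrightarrow> \<gamma> t \<le> \<beta> t * y"
  shows "potential y = potential x + slope x * (y - x) + 2 * max (y - x) 0 / x"
proof -
  have "lower_excess y = cumulative \<gamma> x - cumulative \<beta> x * y"
    by (rule lower_excess_eq) (use assms(4,5) in auto)
  then show ?thesis using x y by (simp add: potential_def slope_def algebra_simps)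
qed

text \<open>The kinks q(t) pass y from above at t = x. Here y > x, so the max term contributes, and
  \<open>cumulative_alpha\<close> at x and at b converts the slopes to \<alpha>.\<close>

lemma potential_eq_upper:
  assumes x: "a < x" "x < b" and y: "b \<le> y"
    and "\<And>t. t < x \<Longrightarrow> \<alpha> t * y \<le> \<gamma> t" "\<And>t. x \<le> t \<Longrightarrow> \<gamma> t \<le> \<alpha> t * y"
  shows "potential y = potential x + slope x * (y - x) + 2 * max (y - x) 0 / x"
proof -
  have eq: "upper_excess y =
      (cumulative \<alpha> b - cumulative \<alpha> x) * y - (cumulative \<gamma> b - cumulative \<gamma> x)"
    by (rule upper_excess_eq) (use assms(4,5) in auto)
  have "(cumulative \<alpha> b + 2 / a) * y = (cumulative \<beta> b + 2 / b) * y"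
    "(cumulative \<alpha> x + 2 / a) * y = (cumulative \<beta> x + 2 / x) * y"
    using cumulative_alpha[of b] cumulative_alpha[of x] x by simp_all
  moreover have "2 / x * x = 2" using x a_pos by simp
  ultimately show ?thesis
    using eq x y
    by (simp add: potential_def slope_def algebra_simps diff_divide_distrib)
qed

text \<open>Boundedness is what allows \<open>integral_bounded_mult\<close> to give the
  \<open>L\<close> term mean zero.\<close>

lemma slope_bounded: "\<exists>K. \<forall>x>0. \<bar>slope x\<bar> \<le> K"
proof (intro exI allI impI)
  fix x :: real assume x: "0 < x"
  have ab: "0 < a" "0 < b" using a_pos a_less_b by auto
  have B: "cumulative \<beta> b \<ge> 0" "cumulative \<alpha> b \<ge> 0"
    using lower_slope_bounds[of 0] upper_slope_bounds[of 0] by linarith+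
  have "0 \<le> cumulative \<beta> x" "cumulative \<beta> x \<le> cumulative \<beta> b" if "a < x" "x < b"
    using monoD[OF cumulative_mono[OF beta_int beta_nonneg], of a x] that
      monoD[OF cumulative_mono[OF beta_int beta_nonneg], of x b] by (simp_all add: cumulative_at_a)
  moreover have "0 \<le> 2 / x" "2 / x \<le> 2 / b" if "b \<le> x"
    using that ab x by (auto intro!: divide_left_mono)
  moreover have "0 \<le> 2 / b" using ab by simp
  moreover have "x \<le> a \<or> a < x \<and> x < b \<or> b \<le> x" by linarith
  ultimately consider "x \<le> a" | "a < x" "x < b" "0 \<le> cumulative \<beta> x" "cumulative \<beta> x \<le> cumulative \<beta> b"
    | "b \<le> x" "0 \<le> 2 / x" "2 / x \<le> 2 / b" by blast
  then show "\<bar>slope x\<bar> \<le> cumulative \<beta> b + 2 / b + cumulative \<alpha> b"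
  proof cases
    case 1
    then have "slope x = lower_slope x" by (simp add: slope_def)
    then show ?thesis using lower_slope_bounds[of x] B \<open>0 \<le> 2 / b\<close> by linarith
  next
    case 2
    then have "slope x = cumulative \<beta> x" by (simp add: slope_def)
    then show ?thesis using 2 B \<open>0 \<le> 2 / b\<close> by linarith
  next
    case 3
    then have "slope x = cumulative \<beta> b + 2 / b - 2 / x - upper_slope x"
      using a_less_b by (simp add: slope_def)
    then show ?thesis using 3 upper_slope_bounds[of x] B by linarith
  qed
qed

text \<open>Linear growth makes the potential integrable against measures of finite mean. Both
  bounds come from \<open>potential_le\<close>: with base point a for the upper one, and with base
  point y evaluated at a for the lower one.\<close>

lemma potential_linear_growth: "\<exists>K. \<forall>y>0. \<bar>potential y\<bar> \<le> K * (1 + y)"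
proof -
  obtain K where K: "\<bar>slope x\<bar> \<le> K" if "0 < x" for x using slope_bounded by blast
  have up: "potential y \<le> \<bar>potential a\<bar> + K * (y + a) + 2 * (y + a) / a" if "0 < y" for y
  proof -
    have "slope a * (y - a) \<le> \<bar>slope a * (y - a)\<bar>" by simp
    also have "\<dots> \<le> K * (y + a)"
      unfolding abs_mult using K[OF a_pos] that a_pos by (intro mult_mono) auto
    finally have "slope a * (y - a) \<le> K * (y + a)" .
    moreover have "2 * max (y - a) 0 / a \<le> 2 * (y + a) / a"
      using that a_pos by (intro divide_right_mono mult_left_mono) auto
    ultimately show ?thesis using potential_le[OF a_pos, of y] that by linarith
  qed
  have low: "potential a - K * (y + a) - 2 * max (a - y) 0 / y \<le> potential y" if "0 < y" for y
  proof -
    have "slope y * (a - y) \<le> \<bar>slope y * (a - y)\<bar>" by simp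
    also have "\<dots> \<le> K * (y + a)"
      unfolding abs_mult using K[OF that] that a_pos by (intro mult_mono) auto
    finally show ?thesis using potential_le[OF that, of a] a_pos by linarith
  qed
  \<comment> \<open>The bound \<open>low\<close> contains 2(a - y)/y, which blows up as y tends to
    0; below a, monotonicity of the potential replaces it.\<close>
  have low0: "- lower_excess 0 \<le> potential y" if "0 < y" "y \<le> a" for y
    using monoD[OF lower_excess_antimono, of 0 y] that by (simp add: potential_def)
  have K0: "0 \<le> K" using K[OF a_pos] by linarith
  have E0: "0 \<le> lower_excess 0" by (rule lower_excess_nonneg)
  define D where "D = lower_excess 0 + \<bar>potential a\<bar> + K + K * a + 2 + 2 / a"
  show ?thesis
  proof (intro exI allI impI)
    fix y :: real assume y: "0 < y"
    have "- (lower_excess 0 + \<bar>potential a\<bar> + K * (y + a)) \<le> potential y"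
    proof (cases "y \<le> a")
      case True
      then show ?thesis using low0[OF y True] K0 a_pos y
        mult_nonneg_nonneg[OF K0, of "y + a"] by linarith
    next
      case False
      then show ?thesis using low[OF y] E0 by simp
    qed
    moreover have "2 * (y + a) / a = 2 / a * y + 2" using a_pos by (simp add: field_simps)
    ultimately have "\<bar>potential y\<bar> \<le> lower_excess 0 + \<bar>potential a\<bar> + K * (y + a) + (2 / a * y + 2)"
      using up[OF y] E0 y a_pos by (intro abs_leI) (auto simp: add_increasing2)
    also have "\<dots> \<le> D * (1 + y)"
    proof -
      have "0 \<le> lower_excess 0 * y" "0 \<le> \<bar>potential a\<bar> * y" "0 \<le> K" "0 \<le> K * a * y"
        "0 \<le> 2 * y" "0 \<le> 2 / a"
        using E0 K0 a_pos y by auto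
      then show ?thesis by (simp add: D_def algebra_simps add_divide_distrib)
    qed
    finally show "\<bar>potential y\<bar> \<le> D * (1 + y)" .
  qed
qed

end

section \<open>The weights determined by p and q\<close>

lemma integrable_bounded_continuous_interval:
  fixes f :: "real \<Rightarrow> real"
  assumes "continuous_on {a<..<b} f" and "\<And>t. t \<in> {a<..<b} \<Longrightarrow> \<bar>f t\<bar> \<le> K"
  shows "integrable lborel (\<lambda>t. indicator {a<..<b} t * f t)"
proof (rule Bochner_Integration.integrable_bound)
  show "integrable lborel (\<lambda>t. indicator {a<..<b} t *\<^sub>R K)"
    by (auto intro!: integrable_scaleR_left integrable_real_indicator emeasure_bounded_finite)
  show "(\<lambda>t. indicator {a<..<b} t * f t) \<in> borel_measurable lborel"
    using borel_measurable_continuous_on_indicator[OF _ assms(1)] by simp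
  show "AE t in lborel. norm (indicator {a<..<b} t * f t) \<le> norm (indicator {a<..<b} t *\<^sub>R K)"
    using assms(2) by (intro AE_I2) (force simp: indicator_def)
qed

text \<open>
  The weights are the derivatives of \<open>h(x) + 1/x\<close> and \<open>h(x) - 1/x\<close>, where \<open>h\<close> solves the
  first-order conditions for an affine function with a kink at \<open>x\<close> to touch the potential at
  \<open>p x\<close> and \<open>q x\<close>.
\<close>

lemma dual_potential_exists:
  fixes a b :: real and p q :: "real \<Rightarrow> real"
  assumes ab: "0 < a" "a < b"
    and p: "p \<in> {a<..<b} \<rightarrow> {0..a}" "continuous_on {a<..<b} p" "antimono_on {a<..<b} p"
    and q: "q \<in> {a<..<b} \<rightarrow> {b..}" "continuous_on {a<..<b} q" "antimono_on {a<..<b} q"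
  obtains \<psi> L :: "real \<Rightarrow> real" and K M :: real
  where "\<psi> \<in> borel_measurable borel" "L \<in> borel_measurable borel"
    and "\<And>x. 0 < x \<Longrightarrow> \<bar>L x\<bar> \<le> K" "\<And>y. 0 < y \<Longrightarrow> \<bar>\<psi> y\<bar> \<le> M * (1 + y)"
    and "\<And>x y. 0 < x \<Longrightarrow> 0 \<le> y \<Longrightarrow> \<psi> y \<le> \<psi> x + L x * (y - x) + 2 * max (y - x) 0 / x"
    and "\<And>x y. x \<in> {a<..<b} \<Longrightarrow> y = p x \<or> y = q x \<Longrightarrow>
      \<psi> y = \<psi> x + L x * (y - x) + 2 * max (y - x) 0 / x"
proof -
  define I where "I = {a<..<b}"
  have pt: "0 \<le> p t" "p t \<le> a" and qt: "b \<le> q t" and d: "0 < q t - p t" "b - a \<le> q t - p t"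
    and t0: "0 < t" "a \<le> t" if "t \<in> I" for t
  proof -
    show "0 \<le> p t" "p t \<le> a" "b \<le> q t" using that p(1) q(1) by (auto simp: I_def Pi_iff)
    then show "0 < q t - p t" "b - a \<le> q t - p t" using ab by auto
    show "0 < t" "a \<le> t" using that ab by (auto simp: I_def)
  qed
  \<comment> \<open>Common factor of the three weights; it gives \<beta> - \<alpha> = w (q - p),
    which is 2 divided by the square of t.\<close>
  define w where "w t = 2 / (t\<^sup>2 * (q t - p t))" for t
  define \<alpha> where "\<alpha> t = indicator I t * (w t * p t)" for t
  define \<beta> where "\<beta> t = indicator I t * (w t * q t)" for t
  define \<gamma> where "\<gamma> t = indicator I t * (w t * (p t * q t))" for t
  have w0: "0 \<le> w t" if "t \<in> I" for t
    using d[OF that] by (simp add: w_def)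
  have w_le: "w t \<le> 2 / (a\<^sup>2 * (b - a))" if "t \<in> I" for t
  proof -
    have "a\<^sup>2 \<le> t\<^sup>2" using t0[OF that] ab by (intro power_mono) auto
    then have "a\<^sup>2 * (b - a) \<le> t\<^sup>2 * (q t - p t)"
      using d[OF that] ab by (intro mult_mono) auto
    moreover have "0 < a\<^sup>2 * (b - a)" using ab by simp
    ultimately show ?thesis unfolding w_def by (intro frac_le) (assumption | simp)+
  qed
  \<comment> \<open>The function q may be unbounded near a, but q/(q - p) decreases in q and
    increases in p, hence is at most b/(b - a).\<close>
  have wq_le: "w t * q t \<le> 2 / (a\<^sup>2 * (b - a)) * b" if t: "t \<in> I" for t
  proof -
    have "p t * b \<le> a * q t" using pt[OF t] qt[OF t] ab by (intro mult_mono) auto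
    then have "q t * (b - a) \<le> b * (q t - p t)" by (simp add: algebra_simps)
    then have 1: "q t / (q t - p t) \<le> b / (b - a)"
      using d[OF t] ab by (simp add: pos_divide_le_eq pos_le_divide_eq)
    have "a\<^sup>2 \<le> t\<^sup>2" using t0[OF t] ab by (intro power_mono) auto
    then have 2: "2 / t\<^sup>2 \<le> 2 / a\<^sup>2" using t0[OF t] ab by (intro divide_left_mono) auto
    have "0 \<le> q t / (q t - p t)" using qt[OF t] d[OF t] ab by simp
    then have "2 / t\<^sup>2 * (q t / (q t - p t)) \<le> 2 / a\<^sup>2 * (b / (b - a))"
      by (intro mult_mono[OF 2 1]) auto
    then show ?thesis by (simp add: w_def)
  qed
  have cw: "continuous_on I w"
  proof -
    have "t\<^sup>2 * (q t - p t) \<noteq> 0" if "t \<in> I" for t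
      using t0(1)[OF that] d(1)[OF that] by simp
    moreover have "continuous_on I p" "continuous_on I q" using p(2) q(2) by (simp_all add: I_def)
    ultimately show ?thesis unfolding w_def[abs_def] by (intro continuous_intros) auto
  qed
  have inta: "integrable lborel \<alpha>"
    unfolding \<alpha>_def[abs_def] I_def
  proof (rule integrable_bounded_continuous_interval)
    show "continuous_on {a<..<b} (\<lambda>t. w t * p t)"
      using cw p(2) unfolding I_def by (rule continuous_on_mult)
    show "\<bar>w t * p t\<bar> \<le> 2 / (a\<^sup>2 * (b - a)) * a" if "t \<in> {a<..<b}" for t
    proof -
      have t: "t \<in> I" using that by (simp add: I_def)
      have "\<bar>w t * p t\<bar> = w t * p t" using w0[OF t] pt[OF t] by simp
      also have "\<dots> \<le> 2 / (a\<^sup>2 * (b - a)) * a"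
        using w_le[OF t] pt[OF t] ab by (intro mult_mono) auto
      finally show ?thesis .
    qed
  qed
  have intb: "integrable lborel \<beta>"
    unfolding \<beta>_def[abs_def] I_def
  proof (rule integrable_bounded_continuous_interval)
    show "continuous_on {a<..<b} (\<lambda>t. w t * q t)"
      using cw q(2) unfolding I_def by (rule continuous_on_mult)
    show "\<bar>w t * q t\<bar> \<le> 2 / (a\<^sup>2 * (b - a)) * b" if "t \<in> {a<..<b}" for t
    proof -
      have t: "t \<in> I" using that by (simp add: I_def)
      have "\<bar>w t * q t\<bar> = w t * q t" using w0[OF t] qt[OF t] ab by simp
      then show ?thesis using wq_le[OF t] by simp
    qed
  qed
  have intc: "integrable lborel \<gamma>"
    unfolding \<gamma>_def[abs_def] I_def
  proof (rule integrable_bounded_continuous_interval)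
    show "continuous_on {a<..<b} (\<lambda>t. w t * (p t * q t))"
      using cw continuous_on_mult[OF p(2) q(2)] unfolding I_def by (rule continuous_on_mult)
    show "\<bar>w t * (p t * q t)\<bar> \<le> 2 / (a\<^sup>2 * (b - a)) * b * a" if "t \<in> {a<..<b}" for t
    proof -
      have t: "t \<in> I" using that by (simp add: I_def)
      have "0 \<le> w t * q t" using w0[OF t] qt[OF t] ab by auto
      then have "(w t * q t) * p t \<le> 2 / (a\<^sup>2 * (b - a)) * b * a"
        using pt[OF t] ab by (intro mult_mono[OF wq_le[OF t] pt(2)[OF t]]) auto
      moreover have "0 \<le> (w t * q t) * p t" using \<open>0 \<le> w t * q t\<close> pt[OF t] by auto
      moreover have "w t * (p t * q t) = (w t * q t) * p t" by simp
      ultimately show ?thesis by (metis abs_of_nonneg)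
    qed
  qed
  have gb: "\<gamma> t = \<beta> t * p t" and ga: "\<gamma> t = \<alpha> t * q t" for t
    by (simp_all add: \<alpha>_def \<beta>_def \<gamma>_def)
  have a0: "0 \<le> \<alpha> t" and b0: "0 \<le> \<beta> t" for t
    using w0[of t] pt[of t] qt[of t] ab by (auto simp: \<alpha>_def \<beta>_def indicator_def)
  have out: "t \<notin> I \<Longrightarrow> \<alpha> t = 0 \<and> \<beta> t = 0 \<and> \<gamma> t = 0" for t
    by (simp add: \<alpha>_def \<beta>_def \<gamma>_def)
  interpret dual_weights a b \<alpha> \<beta> \<gamma>
  proof
    show "\<beta> t - \<alpha> t = indicator {a<..<b} t * (2 / t\<^sup>2)" for t
    proof (cases "t \<in> I")
      case True
      have "2 / (s * e) * e = 2 / s" if "e \<noteq> 0" for s e :: real using that by simp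
      from this[of "q t - p t" "t\<^sup>2"] have "w t * (q t - p t) = 2 / t\<^sup>2"
        using d(1)[OF True] by (simp only: w_def)
      then show ?thesis using True by (simp add: \<alpha>_def \<beta>_def I_def algebra_simps)
    qed (use out[of t] in \<open>simp add: I_def\<close>)
    show "0 \<le> \<gamma> t" for t
      using b0[of t] pt[of t] out[of t] by (cases "t \<in> I") (auto simp: gb)
    show "\<gamma> t \<le> \<beta> t * a" for t
      using b0[of t] pt[of t] out[of t]
      by (cases "t \<in> I") (auto simp: gb intro!: mult_left_mono)
    show "\<alpha> t * b \<le> \<gamma> t" for t
      using a0[of t] qt[of t] out[of t]
      by (cases "t \<in> I") (auto simp: ga intro!: mult_left_mono)
    show "t \<notin> {a<..<b} \<Longrightarrow> \<beta> t = 0" for t using out[of t] by (simp add: I_def)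
  qed (fact ab inta intb intc a0 b0)+
  obtain K where K: "\<And>x. 0 < x \<Longrightarrow> \<bar>slope x\<bar> \<le> K" using slope_bounded by blast
  obtain M where M: "\<And>y. 0 < y \<Longrightarrow> \<bar>potential y\<bar> \<le> M * (1 + y)"
    using potential_linear_growth by blast
  have contact: "potential y = potential x + slope x * (y - x) + 2 * max (y - x) 0 / x"
    if x: "x \<in> {a<..<b}" and y: "y = p x \<or> y = q x" for x y
    using y
  proof
    assume y: "y = p x"
    show ?thesis
    proof (rule potential_eq_lower)
      show "a < x" "x < b" using x by auto
      show "y \<le> a" using pt[of x] x y by (simp add: I_def)
      \<comment> \<open>As p is antitone, p(t) \<ge> p(x) for t < x and p(t) \<le> p(x) for t \<ge>
        x: exactly the sign change required for contact. The same holds for q below.\<close>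
      show "\<beta> t * y \<le> \<gamma> t" if "t < x" for t
        using monotone_onD[OF p(3), of t x] that x b0[of t] out[of t] y
        by (cases "t \<in> I") (auto simp: gb I_def intro!: mult_left_mono)
      show "\<gamma> t \<le> \<beta> t * y" if "x \<le> t" for t
        using monotone_onD[OF p(3), of x t] that x b0[of t] out[of t] y
        by (cases "t \<in> I") (auto simp: gb I_def intro!: mult_left_mono)
    qed
  next
    assume y: "y = q x"
    show ?thesis
    proof (rule potential_eq_upper)
      show "a < x" "x < b" using x by auto
      show "b \<le> y" using qt[of x] x y by (simp add: I_def)
      show "\<alpha> t * y \<le> \<gamma> t" if "t < x" for t
        using monotone_onD[OF q(3), of t x] that x a0[of t] out[of t] y
        by (cases "t \<in> I") (auto simp: ga I_def intro!: mult_left_mono)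
      show "\<gamma> t \<le> \<alpha> t * y" if "x \<le> t" for t
        using monotone_onD[OF q(3), of x t] that x a0[of t] out[of t] y
        by (cases "t \<in> I") (auto simp: ga I_def intro!: mult_left_mono)
    qed
  qed
  show thesis
    by (rule that[of potential slope K M])
      (fact potential_measurable slope_measurable K M potential_le contact)+
qed

section \<open>Support of the Hobson-Klimmek coupling\<close>

text \<open>Disjoint neighbourhoods of \<open>g x\<close> and \<open>y\<close>, the first pulled
  back by continuity, give an open rectangle around (x, y) that misses the graph over
  \<open>I\<close>. Such rectangles carry no kernel mass.\<close>

lemma separate_from_graph:
  fixes g :: "'a::topological_space \<Rightarrow> 'b::t2_space"
  assumes "continuous_on I g" "x \<in> I" "g x \<noteq> y"
  obtains U V where "open U" "open V" "x \<in> U" "y \<in> V" "\<And>x'. x' \<in> I \<inter> U \<Longrightarrow> g x' \<notin> V"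
proof -
  obtain W V where W: "open W" "open V" "g x \<in> W" "y \<in> V" "W \<inter> V = {}"
    using hausdorff[OF assms(3)] by blast
  obtain U where "open U" "x \<in> U" "\<forall>x'\<in>I. x' \<in> U \<longrightarrow> g x' \<in> W"
    using assms(1,2) W(1,3) unfolding continuous_on_topological by blast
  then show thesis using that[of U V] W by blast
qed

text \<open>
  The complement of the three graphs is a countable union of rectangles of zero kernel mass, so
  neither measurability of the kernel nor nonnegativity of its weights is needed.
\<close>

lemma HK_kernel_support:
  fixes Q :: "(real \<times> real) measure"
  assumes sets_Q: "sets Q = sets (borel \<Otimes>\<^sub>M borel)"
    and cont: "continuous_on {a<..<b} p" "continuous_on {a<..<b} q"
    and rect: "\<forall>A\<in>sets borel. \<forall>B\<in>sets borel.
           emeasure Q (A \<times> B) = (\<integral>\<^sup>+x\<in>A. HK_kernel a b p q l u x B \<partial>\<mu>)"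
  shows "AE \<omega> in Q. snd \<omega> = fst \<omega> \<or>
           fst \<omega> \<in> {a<..<b} \<and> (snd \<omega> = p (fst \<omega>) \<or> snd \<omega> = q (fst \<omega>))"
proof -
  define I where "I = {a<..<b}"
  obtain \<B> :: "real set set" where \<B>: "countable \<B>" "topological_basis \<B>"
    using ex_countable_basis by blast
  \<comment> \<open>Sides from a countable basis keep the family countable. Cutting with
    \<open>I\<close> or its complement keeps each rectangle within one branch of the kernel.\<close>
  define \<R> where "\<R> = {R \<in> (\<lambda>(J, U, V). (J \<inter> U) \<times> V) ` ({I, - I} \<times> \<B> \<times> \<B>). R \<in> null_sets Q}"
  have null: "(J \<inter> U) \<times> V \<in> null_sets Q"
    if "J \<in> {I, - I}" "open U" "open V" "\<And>x. x \<in> J \<inter> U \<Longrightarrow> HK_kernel a b p q l u x V = 0"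
    for J U V
  proof -
    have m: "J \<inter> U \<in> sets borel" "V \<in> sets borel" using that(1-3) by (auto simp: I_def)
    then have "emeasure Q ((J \<inter> U) \<times> V) =
        (\<integral>\<^sup>+x. HK_kernel a b p q l u x V * indicator (J \<inter> U) x \<partial>\<mu>)"
      using rect by simp
    also have "(\<lambda>x. HK_kernel a b p q l u x V * indicator (J \<inter> U) x) = (\<lambda>x. 0)"
      using that(4) by (auto simp: fun_eq_iff indicator_def)
    finally have "emeasure Q ((J \<inter> U) \<times> V) = 0" by simp
    moreover have "(J \<inter> U) \<times> V \<in> sets Q" unfolding sets_Q using m by (rule pair_measureI)
    ultimately show ?thesis by auto
  qed
  have cover: "\<omega> \<in> \<Union>\<R>"
    if bad: "\<not> (snd \<omega> = fst \<omega> \<or> fst \<omega> \<in> I \<and> (snd \<omega> = p (fst \<omega>) \<or> snd \<omega> = q (fst \<omega>)))"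
    for \<omega>
  proof -
    obtain x y where \<omega>: "\<omega> = (x, y)" by (cases \<omega>)
    have ne: "x \<noteq> y" "x \<in> I \<Longrightarrow> p x \<noteq> y" "x \<in> I \<Longrightarrow> q x \<noteq> y" using bad by (auto simp: \<omega>)
    obtain U0 V0 where 0: "open U0" "open V0" "x \<in> U0" "y \<in> V0" "\<And>x'. x' \<in> U0 \<Longrightarrow> x' \<notin> V0"
      using separate_from_graph[of UNIV "\<lambda>x. x" x y] ne(1) by auto
    obtain J U V where J: "J \<in> {I, - I}" "x \<in> J" "open U" "open V" "x \<in> U" "y \<in> V"
      "\<And>x'. x' \<in> J \<inter> U \<Longrightarrow> HK_kernel a b p q l u x' V = 0"
    proof (cases "x \<in> I")
      case True
      obtain U1 V1 where 1: "open U1" "open V1" "x \<in> U1" "y \<in> V1"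
        "\<And>x'. x' \<in> I \<inter> U1 \<Longrightarrow> p x' \<notin> V1"
        using separate_from_graph[of I p x y] cont(1) ne(2) True by (auto simp: I_def)
      obtain U2 V2 where 2: "open U2" "open V2" "x \<in> U2" "y \<in> V2"
        "\<And>x'. x' \<in> I \<inter> U2 \<Longrightarrow> q x' \<notin> V2"
        using separate_from_graph[of I q x y] cont(2) ne(3) True by (auto simp: I_def)
      show thesis
      proof (rule that[of I "U0 \<inter> U1 \<inter> U2" "V0 \<inter> V1 \<inter> V2"])
        show "HK_kernel a b p q l u x' (V0 \<inter> V1 \<inter> V2) = 0" if "x' \<in> I \<inter> (U0 \<inter> U1 \<inter> U2)" for x'
          using that 0(5)[of x'] 1(5)[of x'] 2(5)[of x'] by (auto simp: HK_kernel_def)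
      qed (use 0 1 2 True in auto)
    next
      case False
      show thesis
      proof (rule that[of "- I" U0 V0])
        show "HK_kernel a b p q l u x' V0 = 0" if "x' \<in> - I \<inter> U0" for x'
          using that 0(5)[of x'] by (auto simp: HK_kernel_def I_def)
      qed (use 0 False in auto)
    qed
    \<comment> \<open>The rectangle found is null; shrinking its sides to basis sets puts it into
      the countable family.\<close>
    obtain U' where U': "U' \<in> \<B>" "x \<in> U'" "U' \<subseteq> U"
      using topological_basisE[OF \<B>(2) J(3,5)] by blast
    obtain V' where V': "V' \<in> \<B>" "y \<in> V'" "V' \<subseteq> V"
      using topological_basisE[OF \<B>(2) J(4,6)] by blast
    have "(J \<inter> U) \<times> V \<in> null_sets Q" by (rule null) (use J in auto)
    then have "(J \<inter> U') \<times> V' \<in> null_sets Q"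
    proof (rule null_sets_subset)
      have "J \<inter> U' \<in> sets borel" "V' \<in> sets borel"
        using J(1) topological_basis_open[OF \<B>(2)] U'(1) V'(1) by (auto simp: I_def)
      then show "(J \<inter> U') \<times> V' \<in> sets Q" unfolding sets_Q by (rule pair_measureI)
    qed (use U' V' in auto)
    moreover have "(J \<inter> U') \<times> V' \<in> (\<lambda>(J, U, V). (J \<inter> U) \<times> V) ` ({I, - I} \<times> \<B> \<times> \<B>)"
      by (rule image_eqI[of _ _ "(J, U', V')"]) (simp_all only: prod.case mem_Sigma_iff J U' V' simp_thms)
    ultimately have "(J \<inter> U') \<times> V' \<in> \<R>" unfolding \<R>_def by blast
    moreover have "\<omega> \<in> (J \<inter> U') \<times> V'" using J(2) U'(2) V'(2) by (simp add: \<omega>)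
    ultimately show ?thesis by (rule UnionI)
  qed
  have "countable \<R>" unfolding \<R>_def
    by (rule countable_subset[OF Collect_restrict]) (simp add: \<B>(1))
  then have "(\<Union>R\<in>\<R>. R) \<in> null_sets Q"
    by (rule null_sets_UN') (auto simp: \<R>_def)
  then show ?thesis by (rule AE_I') (use cover in \<open>auto simp: I_def\<close>)
qed

section \<open>Optimality by duality\<close>

text \<open>Both couplings have the same marginals and hence the same dual value in
  \<open>duality_gap\<close>. If a < b, the integrated slack is zero under \<open>H\<close> and
  nonnegative under \<open>Q\<close>.\<close>

lemma HK_form_minimizes:
  assumes mu: "\<mu> \<in> P1" and nu: "\<nu> \<in> P1"
    and H: "H \<in> martingale_couplings \<mu> \<nu>" "HK_form \<mu> \<nu> H"
    and Q: "Q \<in> martingale_couplings \<mu> \<nu>"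
  shows "(\<integral>\<omega>. \<bar>snd \<omega> / fst \<omega> - 1\<bar> \<partial>H) \<le> (\<integral>\<omega>. \<bar>snd \<omega> / fst \<omega> - 1\<bar> \<partial>Q)"
proof -
  have locale_H: "martingale_coupling H \<mu> \<nu>" and locale_Q: "martingale_coupling Q \<mu> \<nu>"
    using H(1) Q mu nu
    by (auto simp: martingale_coupling_def martingale_coupling_axioms_def martingale_couplings_def)
  interpret H: martingale_coupling H \<mu> \<nu> by (rule locale_H)
  interpret Q: martingale_coupling Q \<mu> \<nu> by (rule locale_Q)
  obtain a b p q l u where ab: "0 < a" "0 < b"
    and p: "p \<in> {a<..<b} \<rightarrow> {0..a}" "continuous_on {a<..<b} p" "antimono_on {a<..<b} p"
    and q: "q \<in> {a<..<b} \<rightarrow> {b..}" "continuous_on {a<..<b} q" "antimono_on {a<..<b} q"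
    and rect: "\<forall>A\<in>sets borel. \<forall>B\<in>sets borel.
       emeasure H (A \<times> B) = (\<integral>\<^sup>+x\<in>A. HK_kernel a b p q l u x B \<partial>\<mu>)"
    using H(2) unfolding HK_form_def by blast
  note support = HK_kernel_support[OF H.sets_Q p(2) q(2) rect]
  show ?thesis
  proof (cases "a < b")
    \<comment> \<open>The interval (a,b) is empty, so \<open>H\<close> lives on the diagonal and its
      cost is 0.\<close>
    case False
    have "AE \<omega> in H. \<bar>snd \<omega> / fst \<omega> - 1\<bar> = 0"
      using support H.AE_pos by eventually_elim (use False in auto)
    then have "(\<integral>\<omega>. \<bar>snd \<omega> / fst \<omega> - 1\<bar> \<partial>H) = 0" by (rule integral_eq_zero_AE)
    then show ?thesis by simp
  next
    case True
    obtain \<psi> L K M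
      where meas [measurable]: "\<psi> \<in> borel_measurable borel" "L \<in> borel_measurable borel"
      and L: "\<And>x. 0 < x \<Longrightarrow> \<bar>L x\<bar> \<le> K" and \<psi>: "\<And>y. 0 < y \<Longrightarrow> \<bar>\<psi> y\<bar> \<le> M * (1 + y)"
      and le: "\<And>x y. 0 < x \<Longrightarrow> 0 \<le> y \<Longrightarrow> \<psi> y \<le> \<psi> x + L x * (y - x) + 2 * max (y - x) 0 / x"
      and eq: "\<And>x y. x \<in> {a<..<b} \<Longrightarrow> y = p x \<or> y = q x \<Longrightarrow>
        \<psi> y = \<psi> x + L x * (y - x) + 2 * max (y - x) 0 / x"
      using dual_potential_exists[OF ab(1) True p q] by blast
    have int: "integrable \<rho> \<psi>" if "\<rho> \<in> P1" for \<rho>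
    proof (rule Bochner_Integration.integrable_bound)
      interpret prob_space \<rho> using that by (simp add: P1_def)
      show "integrable \<rho> (\<lambda>y. M * (1 + y))" using that by (auto simp: P1_def)
      have "sets \<rho> = sets borel" using that by (simp add: P1_def)
      then show "\<psi> \<in> borel_measurable \<rho>" using meas(1) measurable_cong_sets by blast
      have "AE y in \<rho>. 0 < y" using that by (simp add: P1_def)
      then show "AE y in \<rho>. norm (\<psi> y) \<le> norm (M * (1 + y))"
        by eventually_elim (use \<psi> in \<open>force simp: real_norm_def\<close>)
    qed
    have "0 \<le> (\<integral>\<omega>. \<psi> (fst \<omega>) + L (fst \<omega>) * (snd \<omega> - fst \<omega>)
        + 2 * max (snd \<omega> - fst \<omega>) 0 / fst \<omega> - \<psi> (snd \<omega>) \<partial>Q)"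
    proof (rule integral_nonneg_AE)
      show "AE \<omega> in Q. 0 \<le> \<psi> (fst \<omega>) + L (fst \<omega>) * (snd \<omega> - fst \<omega>)
          + 2 * max (snd \<omega> - fst \<omega>) 0 / fst \<omega> - \<psi> (snd \<omega>)"
        using Q.AE_pos
      proof eventually_elim
        case (elim \<omega>)
        then show ?case using le[of "fst \<omega>" "snd \<omega>"] by simp
      qed
    qed
    moreover have "(\<integral>\<omega>. \<psi> (fst \<omega>) + L (fst \<omega>) * (snd \<omega> - fst \<omega>)
        + 2 * max (snd \<omega> - fst \<omega>) 0 / fst \<omega> - \<psi> (snd \<omega>) \<partial>H) = 0"
    proof (rule integral_eq_zero_AE)
      show "AE \<omega> in H. \<psi> (fst \<omega>) + L (fst \<omega>) * (snd \<omega> - fst \<omega>)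
          + 2 * max (snd \<omega> - fst \<omega>) 0 / fst \<omega> - \<psi> (snd \<omega>) = 0"
        using support
      proof eventually_elim
        case (elim \<omega>)
        then show ?case using eq[of "fst \<omega>" "snd \<omega>"] by auto
      qed
    qed
    ultimately show ?thesis
      using H.duality_gap[OF meas(2) L int[OF mu] int[OF nu]]
        Q.duality_gap[OF meas(2) L int[OF mu] int[OF nu]] by linarith
  qed
qed

theorem mainTheorem2:
  fixes \<mu> \<nu> :: "real measure" and Q\<^sub>H\<^sub>K :: "(real \<times> real) measure"
  assumes "\<mu> \<in> P1d" and "\<nu> \<in> P1d"
    and "convex_order \<mu> \<nu>"
    and "\<exists>!x. local_maximizer_on {0<..} (dF \<mu> \<nu>) x"
    and "is_HK_coupling \<mu> \<nu> Q\<^sub>H\<^sub>K"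
  shows "(INF Q\<in>martingale_couplings \<mu> \<nu>. \<integral>\<omega>. \<bar>snd \<omega> / fst \<omega> - 1\<bar> \<partial>Q) =
         (\<integral>\<omega>. \<bar>snd \<omega> / fst \<omega> - 1\<bar> \<partial>Q\<^sub>H\<^sub>K)"
proof (rule antisym)
  have H: "Q\<^sub>H\<^sub>K \<in> martingale_couplings \<mu> \<nu>" "HK_form \<mu> \<nu> Q\<^sub>H\<^sub>K" and "\<mu> \<in> P1" "\<nu> \<in> P1"
    using assms by (auto simp: is_HK_coupling_def P1d_def)
  then show "(\<integral>\<omega>. \<bar>snd \<omega> / fst \<omega> - 1\<bar> \<partial>Q\<^sub>H\<^sub>K) \<le>
      (INF Q\<in>martingale_couplings \<mu> \<nu>. \<integral>\<omega>. \<bar>snd \<omega> / fst \<omega> - 1\<bar> \<partial>Q)"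
    by (intro cINF_greatest HK_form_minimizes) auto
  show "(INF Q\<in>martingale_couplings \<mu> \<nu>. \<integral>\<omega>. \<bar>snd \<omega> / fst \<omega> - 1\<bar> \<partial>Q) \<le>
      (\<integral>\<omega>. \<bar>snd \<omega> / fst \<omega> - 1\<bar> \<partial>Q\<^sub>H\<^sub>K)"
    \<comment> \<open>The infimum is taken in the reals, so a lower bound has to be supplied: the
      costs are nonnegative.\<close>
    by (rule cINF_lower[OF _ H(1)]) (auto intro!: bdd_belowI2[where m = 0])
qed

end
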